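(* Let $X$ be a topological semilattice, let $Y$ be a Hausdorff topological semigroup, and let $h:X\to Y$ be a continuous homomorphism. The image $h(X)$ is closed in $Y$ if at least one of the following conditions is satisfied: (1) $X$ is $k$-complete; (2) $X$ is $s$-complete, and $Y$ is a well-separated topological semilattice; (3) $X$ is $c$-complete, and either $X$ is a down-open topological semilattice or $Y$ is a down-open topological semilattice.
   Context: A topological semigroup is a topological space with a continuous associative binary operation. A topological semilattice is a topological space $X$ with a continuous binary operation $(x,y)\mapsto xy$ that is associative, commutative and idempotent ($xx=x$); no separation axiom is assumed unless stated. A semilattice carries the natural partial order: $x\le y$ iff $xy=x$. All order notions ($\inf$, $\sup$) are with respect to this order. A chain is a subset in which any two elements are comparable. For $A\subset X$, ${\downarrow}A=\{x\in X:\exists a\in A\ (x\le a)\}$ and ${\uparrow}A=\{x\in X:\exists a\in A\ (x\ge a)\}$; $A$ is an upper set if $A={\uparrow}A$. $\overline{A}$ denotes topological closure. A topological semilattice $X$ is: - $k$-complete if each non-empty chain $C\subset X$ has $\inf C\in\overline{C}$ and $\sup C\in\overline{C}$ (in particular, both exist in $X$); - $s$-complete if each non-empty subsemilattice $S\subset X$ has $\inf S\in\overline{{\uparrow}S}$ and each non-empty chain $C\subset X$ has $\sup C\in\overline{{\downarrow}C}$ (existence included); - $c$-complete if for each closed upper set $F\subset X$, each non-empty chain $C\subset F$ has $\inf C\in F$ and $\sup C\in\overline{{\downarrow}C}$ in $X$ (existence included). A pospace is a topological space with a partial order that is a closed subset of the square; every Hausdorff topological semilattice with its natural order is a pospace.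 A pospace $(P,\le)$ is: - well-separated if for any points $x<y$ in $P$ there is a neighborhood $V\subset P$ of $y$ with $x\notin{\uparrow}\overline{{\uparrow}\overline{{\uparrow}V}}$; - down-open if for every open $U\subset P$ the set ${\downarrow}U$ is open in $P$. A topological semilattice is called well-separated or down-open if, with its natural partial order, it is a pospace with that property. *)

theory Defs
  imports "HOL-Analysis.Analysis"
begin

text \<open>
  A topological semigroup is a type of class \<open>topological_semigroup_mult\<close> (joint continuity of \<open>*\<close>;
  no separation axiom). A topological semilattice is such a type for which the library predicate
  \<open>semilattice (*)\<close> holds. Partial orders are relations, with \<open>(x, y) \<in> r\<close> read as \<open>x \<le> y\<close>.
\<close>

definition natural_order :: "'a::semigroup_mult rel" where
  "natural_order = {(x, y). x * y = x}"

definition down :: "'a rel \<Rightarrow> 'a set \<Rightarrow> 'a set" where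
  "down r A = {x. \<exists>a\<in>A. (x, a) \<in> r}"

definition up :: "'a rel \<Rightarrow> 'a set \<Rightarrow> 'a set" where
  "up r A = {x. \<exists>a\<in>A. (a, x) \<in> r}"

definition is_inf :: "'a rel \<Rightarrow> 'a set \<Rightarrow> 'a \<Rightarrow> bool" where
  "is_inf r A i \<longleftrightarrow> (\<forall>a\<in>A. (i, a) \<in> r) \<and> (\<forall>l. (\<forall>a\<in>A. (l, a) \<in> r) \<longrightarrow> (l, i) \<in> r)"

definition is_sup :: "'a rel \<Rightarrow> 'a set \<Rightarrow> 'a \<Rightarrow> bool" where
  "is_sup r A s \<longleftrightarrow> (\<forall>a\<in>A. (a, s) \<in> r) \<and> (\<forall>u. (\<forall>a\<in>A. (a, u) \<in> r) \<longrightarrow> (s, u) \<in> r)"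

text \<open>
  The completeness properties below are meant for types satisfying \<open>semilattice (*)\<close>. Then
  \<open>natural_order\<close> is antisymmetric, so the infima and suprema asserted to exist are unique.
\<close>

definition k_complete :: "'a::topological_semigroup_mult itself \<Rightarrow> bool" where
  "k_complete (T :: 'a itself) \<longleftrightarrow>
    (\<forall>C \<in> Chains (natural_order :: 'a rel). C \<noteq> {} \<longrightarrow>
      (\<exists>i. is_inf natural_order C i \<and> i \<in> closure C) \<and>
      (\<exists>s. is_sup natural_order C s \<and> s \<in> closure C))"

definition s_complete :: "'a::topological_semigroup_mult itself \<Rightarrow> bool" where
  "s_complete (T :: 'a itself) \<longleftrightarrow>
    (\<forall>S :: 'a set. S \<noteq> {} \<and> (\<forall>x\<in>S. \<forall>y\<in>S. x * y \<in> S) \<longrightarrow>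
      (\<exists>i. is_inf natural_order S i \<and> i \<in> closure (up natural_order S))) \<and>
    (\<forall>C \<in> Chains (natural_order :: 'a rel). C \<noteq> {} \<longrightarrow>
      (\<exists>s. is_sup natural_order C s \<and> s \<in> closure (down natural_order C)))"

definition c_complete :: "'a::topological_semigroup_mult itself \<Rightarrow> bool" where
  "c_complete (T :: 'a itself) \<longleftrightarrow>
    (\<forall>F :: 'a set. closed F \<and> F = up natural_order F \<longrightarrow>
      (\<forall>C \<in> Chains (natural_order :: 'a rel). C \<noteq> {} \<and> C \<subseteq> F \<longrightarrow>
        (\<exists>i. is_inf natural_order C i \<and> i \<in> F) \<and>
        (\<exists>s. is_sup natural_order C s \<and> s \<in> closure (down natural_order C))))"

definition pospace :: "'a::topological_space rel \<Rightarrow> bool" where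
  "pospace r \<longleftrightarrow> partial_order_on UNIV r \<and> closed r"

text \<open>
  A neighborhood of \<open>y\<close> is any set having \<open>y\<close> in its interior.
\<close>

definition well_separated :: "'a::topological_space rel \<Rightarrow> bool" where
  "well_separated r \<longleftrightarrow> pospace r \<and>
    (\<forall>x y. (x, y) \<in> r \<and> x \<noteq> y \<longrightarrow>
      (\<exists>V. y \<in> interior V \<and> x \<notin> up r (closure (up r (closure (up r V))))))"

definition down_open :: "'a::topological_space rel \<Rightarrow> bool" where
  "down_open r \<longleftrightarrow> pospace r \<and> (\<forall>U. open U \<longrightarrow> open (down r U))"

end

(*
  Let y be in the closure of h(X). For a sequence u of neighborhoods of y with
  u(n+1) u(n+1) contained in u(n), pick x_n with h(x_n) in u(n). The infima w_n of the products
  x_{n+1} ... x_m increase with n, and h(sup w_n) lies in a suitable closure of every u(n); it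
  remains to pass from countably many neighborhoods to all of them.

  If X is k-complete, the intersections Z_u of the closures of h^-1(u(n)) are closed
  subsemilattices with the finite intersection property. They have a common point, by induction
  on cardinality, and h maps that point to y.

  Otherwise replace Z_u by an upper set S_u with infimum e_u. The e_u are directed, and
  h(e_u) y = h(e_u) because e_u lies below sup w_n for all finer sequences. The same compactness
  argument, now applied to principal filters in {x. h(x) y = h(x)}, gives s above all e_u with
  h(s) <= y, and the separation hypotheses exclude h(s) < y.
*)

theory Submission
  imports Defs
begin

section \<open>Order notation; products and images of closures\<close>

abbreviation natural_le :: "'a::semigroup_mult \<Rightarrow> 'a \<Rightarrow> bool"  (infix \<open>\<preceq>\<close> 50) where
  "x \<preceq> y \<equiv> (x, y) \<in> natural_order"

lemma natural_le_iff: "x \<preceq> y \<longleftrightarrow> x * y = x"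
  by (simp add: natural_order_def)

lemma in_closure_iff: "x \<in> closure S \<longleftrightarrow> (\<forall>U. open U \<and> x \<in> U \<longrightarrow> U \<inter> S \<noteq> {})"
  using closure_iff_nhds_not_empty[of x S] by blast

lemma up_mono: "A \<subseteq> B \<Longrightarrow> up r A \<subseteq> up r B"
  unfolding up_def by blast

lemma open_mult_nhds:
  fixes a b :: "'a::topological_semigroup_mult"
  assumes "open W" "a * b \<in> W"
  obtains U V where "open U" "a \<in> U" "open V" "b \<in> V" "\<And>x z. x \<in> U \<Longrightarrow> z \<in> V \<Longrightarrow> x * z \<in> W"
proof -
  have "eventually (\<lambda>p. fst p * snd p \<in> W) (nhds a \<times>\<^sub>F nhds b)"
    using tendsto_mult_Pair[of a b] assms by (simp add: tendsto_def)
  then obtain P Q where "eventually P (nhds a)" "eventually Q (nhds b)"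
      "\<And>x z. P x \<Longrightarrow> Q z \<Longrightarrow> x * z \<in> W"
    unfolding eventually_prod_filter by auto
  then show ?thesis
    unfolding eventually_nhds using that by meson
qed

lemma closure_mult:
  fixes x z :: "'a::topological_semigroup_mult"
  assumes "\<And>a b. a \<in> A \<Longrightarrow> b \<in> B \<Longrightarrow> a * b \<in> C" "x \<in> closure A" "z \<in> closure B"
  shows "x * z \<in> closure C"
  unfolding in_closure_iff
proof (intro allI impI)
  fix W assume W: "open W \<and> x * z \<in> W"
  then obtain U V where UV: "open U" "x \<in> U" "open V" "z \<in> V"
      "\<And>a b. a \<in> U \<Longrightarrow> b \<in> V \<Longrightarrow> a * b \<in> W"
    by (metis open_mult_nhds)
  then obtain a b where "a \<in> U \<inter> A" "b \<in> V \<inter> B"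
    using assms(2,3) unfolding in_closure_iff by blast
  then show "W \<inter> C \<noteq> {}"
    using UV(5) assms(1) by blast
qed

lemma image_in_closure:
  assumes "continuous_on UNIV h" "x \<in> closure A" "h ` A \<subseteq> B"
  shows "h x \<in> closure B"
  using continuous_image_closure_subset[OF assms(1), of A] assms(2,3) closure_mono[OF assms(3)] by auto


section \<open>Compactness of families of sets with least elements\<close>

text \<open>
  Induction on the cardinality of the subfamily: along an initial well-order of an infinite
  subfamily, the least elements of the intersections over proper initial segments form an
  increasing chain, whose supremum lies in every member.
\<close>

lemma finite_intersection_property_least:
  fixes r :: "'a rel" and F :: "'i \<Rightarrow> 'a set"
  assumes antisym: "antisym r"
    and least: "\<And>J. J \<subseteq> I \<Longrightarrow> T \<inter> (\<Inter>j\<in>J. F j) \<noteq> {} \<Longrightarrow>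
      \<exists>m\<in>T \<inter> (\<Inter>j\<in>J. F j). \<forall>x\<in>T \<inter> (\<Inter>j\<in>J. F j). (m, x) \<in> r"
    and sup: "\<And>C. C \<in> Chains r \<Longrightarrow> C \<noteq> {} \<Longrightarrow> C \<subseteq> T \<Longrightarrow>
      \<exists>s\<in>T. \<forall>i\<in>I. \<forall>c\<in>C. (\<forall>d\<in>C. (c, d) \<in> r \<longrightarrow> d \<in> F i) \<longrightarrow> s \<in> F i"
    and fin: "\<And>J. J \<subseteq> I \<Longrightarrow> finite J \<Longrightarrow> T \<inter> (\<Inter>j\<in>J. F j) \<noteq> {}"
  shows "T \<inter> (\<Inter>i\<in>I. F i) \<noteq> {}"
proof -
  \<comment> \<open>The relation \<open>card_of J\<close> is a well-order of \<open>J\<close> of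
    least possible type, so the same \<open>R\<close> serves as the measure of the induction and as
    an enumeration of \<open>J\<close>.\<close>
  have "\<forall>J. card_of J = R \<longrightarrow> J \<subseteq> I \<longrightarrow> T \<inter> (\<Inter>j\<in>J. F j) \<noteq> {}" for R :: "'i rel"
  proof (induction R rule: wf_induct_rule[OF wf_ordLess])
    case (1 R)
    show ?case
    proof (intro allI impI)
      fix J assume J: "card_of J = R" "J \<subseteq> I"
      show "T \<inter> (\<Inter>j\<in>J. F j) \<noteq> {}"
      proof (cases "finite J")
        case True
        then show ?thesis using fin J by blast
      next
        case inf: False
        have co: "Card_order R"
          unfolding J(1)[symmetric] by (rule card_of_Card_order)
        have field: "Field R = J"
          unfolding J(1)[symmetric] by (rule Field_card_of)
        have wo: "Well_order R" using co by (rule card_order_on_well_order_on)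
        have tot: "\<And>a b. a \<in> J \<Longrightarrow> b \<in> J \<Longrightarrow> a \<noteq> b \<Longrightarrow> (a, b) \<in> R \<or> (b, a) \<in> R"
          and tr: "trans R" and as: "antisym R"
          using wo field unfolding order_on_defs total_on_def by auto
        \<comment> \<open>Proper initial segments have smaller cardinality than \<open>J\<close>, so
          the induction hypothesis makes \<open>?Z a\<close> nonempty. Its least element
          \<open>e a\<close> grows with \<open>a\<close> because \<open>?Z a\<close>
          shrinks.\<close>
        let ?Z = "\<lambda>a. T \<inter> (\<Inter>j\<in>underS R a. F j)"
        have sub: "underS R a \<subseteq> J" for a
          using field unfolding underS_def Field_def by auto
        have "\<exists>m\<in>?Z a. \<forall>x\<in>?Z a. (m, x) \<in> r" if "a \<in> J" for a
        proof -
          have "(card_of (underS R a), R) \<in> ordLess"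
            using card_of_underS[OF co] that field by blast
          then have "?Z a \<noteq> {}" using 1 sub[of a] J(2) by blast
          then show ?thesis using least[of "underS R a"] sub[of a] J(2) by blast
        qed
        then obtain e where e: "\<And>a. a \<in> J \<Longrightarrow> e a \<in> ?Z a"
            "\<And>a x. a \<in> J \<Longrightarrow> x \<in> ?Z a \<Longrightarrow> (e a, x) \<in> r"
          by metis
        have mono: "(e a, e b) \<in> r" if "a \<in> J" "b \<in> J" "(a, b) \<in> R \<or> a = b" for a b
        proof -
          have "underS R a \<subseteq> underS R b"
            using that tr as unfolding underS_def by (auto dest: transD antisymD)
          then have "e b \<in> ?Z a" using e(1)[OF that(2)] by blast
          then show ?thesis using e(2) that by blast
        qed
        have "e ` J \<in> Chains r"
          unfolding Chains_def using mono tot by blast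
        moreover have "e ` J \<noteq> {}" using inf by auto
        moreover have "e ` J \<subseteq> T" using e(1) by blast
        ultimately obtain s where s: "s \<in> T"
            "\<And>i c. i \<in> I \<Longrightarrow> c \<in> e ` J \<Longrightarrow> (\<forall>d\<in>e ` J. (c, d) \<in> r \<longrightarrow> d \<in> F i) \<Longrightarrow> s \<in> F i"
          using sup by meson
        have "s \<in> F i" if i: "i \<in> J" for i
        proof -
          \<comment> \<open>An infinite cardinal has no last element. Since \<open>underS\<close>
            omits its end point, \<open>e i\<close> itself need not lie in \<open>F i\<close>, but
            \<open>e a\<close> does for every \<open>a\<close> from \<open>b\<close> on.\<close>
          obtain b where b: "b \<in> J" "i \<noteq> b" "(i, b) \<in> R"
            using infinite_Card_order_limit[OF co] inf i field by blast
          have ib: "e b \<in> F i" using e(1)[OF b(1)] b unfolding underS_def by blast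
          have "d \<in> F i" if d: "d \<in> e ` J" "(e b, d) \<in> r" for d
          proof -
            obtain a where a: "a \<in> J" "d = e a" using d(1) by blast
            show ?thesis
            proof (cases "(b, a) \<in> R")
              case True
              then have "i \<in> underS R a"
                using b tr as unfolding underS_def by (auto dest: transD antisymD)
              then show ?thesis using e(1) a by blast
            next
              \<comment> \<open>Here \<open>a\<close> comes before \<open>b\<close>, so
                \<open>e a\<close> is below \<open>e b\<close>; as \<open>d = e a\<close> is also
                above \<open>e b\<close>, the two coincide.\<close>
              case False
              then have "(e a, e b) \<in> r" using mono tot a(1) b(1) by blast
              then show ?thesis using d(2) a(2) ib antisym by (metis antisymD)
            qed
          qed
          then show ?thesis using s(2)[of i "e b"] b(1) i J(2) by blast
        qed
        then show ?thesis using s(1) by blast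
      qed
    qed
  qed
  then show ?thesis by blast
qed


section \<open>The natural order of a semilattice\<close>

text \<open>An order-theoretic limit inferior of points chosen in the sets \<open>A n\<close>: the
  supremum of increasing infima of tails. Of the tail products only a nonempty chain in
  \<open>A n\<close> with infimum \<open>w n\<close> is recorded, a form to which each notion of
  completeness can be applied.\<close>

definition lower_limit :: "(nat \<Rightarrow> 'a::semigroup_mult set) \<Rightarrow> 'a \<Rightarrow> bool" where
  "lower_limit A s \<longleftrightarrow> (\<exists>w. (\<forall>m n. m \<le> n \<longrightarrow> w m \<preceq> w n) \<and>
    (\<forall>n. \<exists>D\<in>Chains natural_order. D \<noteq> {} \<and> D \<subseteq> A n \<and> is_inf natural_order D (w n)) \<and>
    is_sup natural_order (range w) s)"

context
  assumes semilattice: "semilattice ((*) :: 'a::semigroup_mult \<Rightarrow> 'a \<Rightarrow> 'a)"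
begin

interpretation semilattice "(*) :: 'a \<Rightarrow> 'a \<Rightarrow> 'a"
  by (rule semilattice)

lemma natural_le_refl: "(x :: 'a) \<preceq> x"
  by (simp add: natural_le_iff)

lemma natural_le_antisym: "(x :: 'a) \<preceq> y \<Longrightarrow> y \<preceq> x \<Longrightarrow> x = y"
  unfolding natural_le_iff by (metis commute)

lemma natural_le_trans: "(x :: 'a) \<preceq> y \<Longrightarrow> y \<preceq> z \<Longrightarrow> x \<preceq> z"
  unfolding natural_le_iff by (metis mult.assoc)

lemma natural_mult_le: "(x :: 'a) * y \<preceq> x" "x * y \<preceq> y"
  unfolding natural_le_iff by (simp_all add: mult.assoc commute left_commute)

lemma natural_le_multI: "(l :: 'a) \<preceq> x \<Longrightarrow> l \<preceq> y \<Longrightarrow> l \<preceq> x * y"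
  unfolding natural_le_iff by (metis mult.assoc)

lemma natural_mult_mono: "(a :: 'a) \<preceq> x \<Longrightarrow> b \<preceq> z \<Longrightarrow> a * b \<preceq> x * z"
  by (meson natural_le_multI natural_le_trans natural_mult_le)

lemma up_increasing: "A \<subseteq> up natural_order (A :: 'a set)"
  unfolding up_def using natural_le_refl by blast

lemma up_idem: "up natural_order (up natural_order (A :: 'a set)) = up natural_order A"
  using up_increasing natural_le_trans unfolding up_def by blast

lemma up_mult:
  assumes "\<And>a b. a \<in> A \<Longrightarrow> b \<in> B \<Longrightarrow> a * b \<in> C"
    and "x \<in> up natural_order A" "z \<in> up natural_order (B :: 'a set)"
  shows "x * z \<in> up natural_order C"
  using assms natural_mult_mono unfolding up_def by blast

lemma chain_mult_closed:
  assumes "C \<in> Chains natural_order" "(a :: 'a) \<in> C" "b \<in> C"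
  shows "a * b \<in> C"
  using assms unfolding Chains_def natural_le_iff by (auto, metis commute)

text \<open>Zorn's lemma gives a minimal element \<open>m\<close>. For \<open>x\<close> in
  \<open>Z\<close> the product \<open>m * x\<close> lies in \<open>Z\<close> and below
  \<open>m\<close>, hence equals \<open>m\<close>; so \<open>m\<close> is below
  \<open>x\<close>.\<close>

lemma subsemilattice_has_least:
  assumes "(Z :: 'a set) \<noteq> {}"
    and mult: "\<And>a b. a \<in> Z \<Longrightarrow> b \<in> Z \<Longrightarrow> a * b \<in> Z"
    and chain: "\<And>C. C \<in> Chains natural_order \<Longrightarrow> C \<noteq> {} \<Longrightarrow> C \<subseteq> Z \<Longrightarrow> \<exists>i\<in>Z. \<forall>c\<in>C. i \<preceq> c"
  obtains m where "m \<in> Z" "\<And>x. x \<in> Z \<Longrightarrow> m \<preceq> x"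
proof -
  have "\<exists>m\<in>Z. \<forall>a\<in>Z. a \<preceq> m \<longrightarrow> a = m"
  proof (rule predicate_Zorn[of Z "\<lambda>x y. y \<preceq> x"])
    show "partial_order_on Z (relation_of (\<lambda>x y. y \<preceq> x) Z)"
      using natural_le_refl natural_le_trans natural_le_antisym
      by (intro partial_order_on_relation_ofI) blast+
    fix C assume C: "C \<in> Chains (relation_of (\<lambda>x y. y \<preceq> x) Z)"
    then have "C \<in> Chains natural_order" "C \<subseteq> Z"
      unfolding Chains_def relation_of_def by blast+
    then show "\<exists>u\<in>Z. \<forall>a\<in>C. u \<preceq> a"
      using chain[of C] assms(1) by (cases "C = {}") auto
  qed
  then obtain m where m: "m \<in> Z" "\<And>a. a \<in> Z \<Longrightarrow> a \<preceq> m \<Longrightarrow> a = m" by blast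
  have "m \<preceq> x" if "x \<in> Z" for x
    using m mult[OF m(1) that] natural_mult_le by metis
  then show ?thesis using that m(1) by blast
qed

text \<open>The elements above all lower bounds of \<open>A\<close> form a set that contains
  \<open>A\<close> and is closed under products and infima of chains. Its least element is above
  every lower bound and, since the set contains \<open>A\<close>, is itself a lower bound.\<close>

lemma inf_exists:
  assumes chain: "\<And>C :: 'a set. C \<in> Chains natural_order \<Longrightarrow> C \<noteq> {} \<Longrightarrow> \<exists>i. is_inf natural_order C i"
    and "(A :: 'a set) \<noteq> {}"
  shows "\<exists>i. is_inf natural_order A i"
proof -
  let ?Z = "{z. \<forall>l. (\<forall>a\<in>A. l \<preceq> a) \<longrightarrow> l \<preceq> z}"
  obtain m where m: "m \<in> ?Z" "\<And>x. x \<in> ?Z \<Longrightarrow> m \<preceq> x"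
  proof (rule subsemilattice_has_least[of ?Z])
    show "?Z \<noteq> {}" using assms(2) by blast
    show "a * b \<in> ?Z" if "a \<in> ?Z" "b \<in> ?Z" for a b
      using that natural_le_multI by blast
    fix C assume C: "C \<in> Chains natural_order" "C \<noteq> {}" "C \<subseteq> ?Z"
    then obtain i where i: "\<And>c. c \<in> C \<Longrightarrow> i \<preceq> c" "\<And>l. (\<forall>c\<in>C. l \<preceq> c) \<Longrightarrow> l \<preceq> i"
      using chain unfolding is_inf_def by meson
    have "i \<in> ?Z" using i(2) C(3) by auto
    then show "\<exists>i\<in>?Z. \<forall>c\<in>C. i \<preceq> c"
      using i(1) by blast
  qed blast
  have "m \<preceq> a" if "a \<in> A" for a
    using m(2)[of a] that by blast
  then have "is_inf natural_order A m"
    using m(1) unfolding is_inf_def by auto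
  then show ?thesis ..
qed

lemma lower_limit_exists:
  fixes A :: "nat \<Rightarrow> 'a set"
  assumes inf: "\<And>C :: 'a set. C \<in> Chains natural_order \<Longrightarrow> C \<noteq> {} \<Longrightarrow> \<exists>i. is_inf natural_order C i"
    and sup: "\<And>C :: 'a set. C \<in> Chains natural_order \<Longrightarrow> C \<noteq> {} \<Longrightarrow> \<exists>i. is_sup natural_order C i"
    and ne: "\<And>n. A n \<noteq> {}"
    and mult: "\<And>n a b. a \<in> A (Suc n) \<Longrightarrow> b \<in> A (Suc n) \<Longrightarrow> a * b \<in> A n"
  shows "\<exists>s. lower_limit A s"
proof -
  obtain x where x: "\<And>n. x n \<in> A n" using ne by (meson ex_in_conv)
  \<comment> \<open>\<open>p m n\<close> is the product of \<open>x n\<close>,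
    \<open>x (n + 1)\<close>, ..., \<open>x (n + m)\<close>, built by peeling off the first
    factor.\<close>
  define p where "p = rec_nat x (\<lambda>_ q n. x n * q (Suc n))"
  have p0: "p 0 n = x n" and pS: "p (Suc m) n = x n * p m (Suc n)" for m n
    by (simp_all add: p_def)
  have desc: "A (Suc n) \<subseteq> A n" for n
    using mult[of _ n] by (metis idem subsetI)
  \<comment> \<open>The factor with index n+1 and, by induction, the product of the later ones both
    lie in \<open>A (Suc n)\<close>. A product of any length thus loses only one index in total,
    which is why the chains \<open>D n\<close> start at n+1.\<close>
  have pA: "p m (Suc n) \<in> A n" for m n
    proof (induction m arbitrary: n)
    case 0
    then show ?case using p0 x desc by auto
  next
    case (Suc m)
    then show ?case using pS x mult by simp
  qed
  have p_step: "p (Suc m) n \<preceq> p m n" for m n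
  proof (induction m arbitrary: n)
    case 0
    then show ?case by (simp add: p0 pS natural_mult_le)
  next
    case (Suc m)
    then show ?case using natural_mult_mono[OF natural_le_refl Suc] pS by metis
  qed
  have anti: "p k n \<preceq> p m n" if "m \<le> k" for m k n
    using that by (induction rule: dec_induct) (blast intro: natural_le_refl natural_le_trans p_step)+
  define D where "D n = range (\<lambda>m. p m (Suc n))" for n
  have D: "D n \<in> Chains natural_order" "D n \<noteq> {}" "D n \<subseteq> A n" for n
    using anti pA unfolding D_def Chains_def by (auto, metis nat_le_linear)
  have "\<exists>i. is_inf natural_order (D n) i" for n
    using inf D by blast
  then obtain w where w: "\<And>n. is_inf natural_order (D n) (w n)"
    by metis
  have w_step: "w n \<preceq> w (Suc n)" for n
  proof -
    \<comment> \<open>Dropping the first factor only enlarges a product, so \<open>w n\<close> is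
      also a lower bound of the chain that starts one index later.\<close>
    have "w n \<preceq> p m (Suc (Suc n))" for m
    proof -
      have "w n \<preceq> p (Suc m) (Suc n)"
        using w[of n] unfolding is_inf_def D_def by blast
      then show ?thesis using pS natural_mult_le natural_le_trans by metis
    qed
    then show ?thesis using w[of "Suc n"] unfolding is_inf_def D_def by blast
  qed
  have mono: "w m \<preceq> w n" if "m \<le> n" for m n
    using that by (induction rule: dec_induct) (blast intro: natural_le_refl natural_le_trans w_step)+
  then have "range w \<in> Chains natural_order"
    unfolding Chains_def by (auto, metis nat_le_linear)
  then obtain s where "is_sup natural_order (range w) s" using sup by blast
  then have "lower_limit A s"
    unfolding lower_limit_def
  proof (intro exI[of _ w] conjI allI impI)
    show "\<exists>D\<in>Chains natural_order. D \<noteq> {} \<and> D \<subseteq> A n \<and> is_inf natural_order D (w n)" for n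
      using D w by (intro bexI[of _ "D n"]) simp_all
  qed (use mono in blast)+
  then show ?thesis ..
qed

lemma is_sup_unique:
  assumes "is_sup natural_order (C :: 'a set) s" "is_sup natural_order C t"
  shows "s = t"
  using assms natural_le_antisym unfolding is_sup_def by blast

lemma is_inf_unique:
  assumes "is_inf natural_order (C :: 'a set) s" "is_inf natural_order C t"
  shows "s = t"
  using assms natural_le_antisym unfolding is_inf_def by blast

end


section \<open>Points in the closure of the image\<close>

text \<open>The assumptions \<open>chain_inf\<close> and \<open>chain_sup\<close> are what the three
  completeness properties have in common. The codomain is just a Hausdorff semigroup, so the
  algebraic identities at \<open>y\<close> must be inherited from the image.\<close>

locale image_limit =
  fixes h :: "'a::topological_semigroup_mult \<Rightarrow> 'b::{topological_semigroup_mult, t2_space}"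
    and y :: 'b
  assumes semilattice: "semilattice ((*) :: 'a \<Rightarrow> 'a \<Rightarrow> 'a)"
    and cont: "continuous_on UNIV h"
    and hom: "\<And>x z. h (x * z) = h x * h z"
    and y_closure: "y \<in> closure (range h)"
    and chain_inf: "\<And>C :: 'a set. C \<in> Chains natural_order \<Longrightarrow> C \<noteq> {} \<Longrightarrow> \<exists>i. is_inf natural_order C i"
    and chain_sup: "\<And>C :: 'a set. C \<in> Chains natural_order \<Longrightarrow> C \<noteq> {} \<Longrightarrow>
      \<exists>s. is_sup natural_order C s \<and> s \<in> closure (down natural_order C)"
begin

interpretation semilattice "(*) :: 'a \<Rightarrow> 'a \<Rightarrow> 'a"
  by (rule semilattice)

lemmas le_refl = natural_le_refl[OF semilattice]
  and le_antisym = natural_le_antisym[OF semilattice]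
  and le_trans = natural_le_trans[OF semilattice]

text \<open>The analogue of halving neighborhoods in a topological group: the condition on
  consecutive terms makes intersections over n of closures or upper sets derived from the preimages
  of \<open>u n\<close> closed under products.\<close>

definition nbhd_seq :: "(nat \<Rightarrow> 'b set) \<Rightarrow> bool" where
  "nbhd_seq u \<longleftrightarrow> (\<forall>n. open (u n) \<and> y \<in> u n \<and> (\<forall>a\<in>u (Suc n). \<forall>b\<in>u (Suc n). a * b \<in> u n))"

text \<open>Equations between continuous maps into a Hausdorff space define closed sets, so
  identities valid on \<open>range h\<close> persist at \<open>y\<close>. The same argument gives
  \<open>y_commute\<close>.\<close>

lemma y_idem: "y * y = y"
proof -
  have "closed {z :: 'b. z * z = z}"
    by (intro closed_Collect_eq continuous_intros)
  moreover have "range h \<subseteq> {z. z * z = z}"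
    using hom by (auto simp flip: hom)
  ultimately show ?thesis
    using closure_minimal y_closure by blast
qed

lemma y_commute: "y * h x = h x * y"
proof -
  have "closed {z :: 'b. z * h x = h x * z}"
    by (intro closed_Collect_eq continuous_intros)
  moreover have "range h \<subseteq> {z. z * h x = h x * z}"
    using commute by (auto simp flip: hom)
  ultimately show ?thesis
    using closure_minimal y_closure by blast
qed

text \<open>Since \<open>y * y = y\<close>, continuity of multiplication at the pair of
  \<open>y\<close> with itself yields, for each neighborhood of \<open>y\<close>, another one whose
  square lies in it. Iterate, staying inside \<open>V\<close>.\<close>

lemma nbhd_seq_exists:
  assumes "open V" "y \<in> V"
  obtains u where "nbhd_seq u" "u 0 \<subseteq> V"
proof -
  have "\<exists>u. \<forall>n. (open (u n) \<and> y \<in> u n \<and> u n \<subseteq> V) \<and> (\<forall>a\<in>u (Suc n). \<forall>b\<in>u (Suc n). a * b \<in> u n)"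
  proof (rule dependent_nat_choice)
    show "\<exists>x. open x \<and> y \<in> x \<and> x \<subseteq> V" using assms by blast
    fix W n assume W: "open W \<and> y \<in> W \<and> W \<subseteq> V"
    then obtain P Q where PQ: "open P" "y \<in> P" "open Q" "y \<in> Q" "\<And>a b. a \<in> P \<Longrightarrow> b \<in> Q \<Longrightarrow> a * b \<in> W"
      using open_mult_nhds[of W y y] y_idem by metis
    show "\<exists>W'. (open W' \<and> y \<in> W' \<and> W' \<subseteq> V) \<and> (\<forall>a\<in>W'. \<forall>b\<in>W'. a * b \<in> W)"
      using PQ W by (intro exI[of _ "P \<inter> Q \<inter> V"]) (use assms in auto)
  qed
  then obtain u where u: "\<forall>n. (open (u n) \<and> y \<in> u n \<and> u n \<subseteq> V) \<and>
      (\<forall>a\<in>u (Suc n). \<forall>b\<in>u (Suc n). a * b \<in> u n)" ..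
  show ?thesis
  proof (rule that)
    show "nbhd_seq u" unfolding nbhd_seq_def using u by simp
    show "u 0 \<subseteq> V" using u by simp
  qed
qed

lemma nbhd_seq_Int:
  assumes "nbhd_seq u" "nbhd_seq v"
  shows "nbhd_seq (\<lambda>n. u n \<inter> v n)"
  using assms unfolding nbhd_seq_def by auto

lemma nbhd_seq_finite:
  assumes "finite J" "J \<subseteq> Collect nbhd_seq"
  shows "\<exists>v. nbhd_seq v \<and> (\<forall>u\<in>J. \<forall>n. v n \<subseteq> u n)"
  using assms
proof (induction J rule: finite_induct)
  case empty
  then show ?case using nbhd_seq_exists[of UNIV] by auto
next
  case (insert u J)
  then obtain v where "nbhd_seq v" "\<forall>u\<in>J. \<forall>n. v n \<subseteq> u n" by auto
  then show ?case
    using nbhd_seq_Int[of u v] insert.prems by (intro exI[of _ "\<lambda>n. u n \<inter> v n"]) auto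
qed

lemma vimage_nbhd_seq_mult:
  assumes "nbhd_seq u" "a \<in> h -` u (Suc n)" "b \<in> h -` u (Suc n)"
  shows "a * b \<in> h -` u n"
  using assms unfolding nbhd_seq_def by (simp add: hom)

text \<open>The sets \<open>u n\<close> themselves need not decrease, as points of the codomain may
  fail to be idempotent. Their preimages do, because \<open>a = a * a\<close> in the domain.\<close>

lemma vimage_nbhd_seq_antimono:
  assumes "nbhd_seq u" "m \<le> n"
  shows "h -` u n \<subseteq> h -` u m"
  using assms(2)
proof (induction rule: dec_induct)
  case (step k)
  have "h -` u (Suc k) \<subseteq> h -` u k"
    using vimage_nbhd_seq_mult[OF assms(1)] idem by (metis subsetI)
  then show ?case using step by blast
qed simp

lemma lower_limit_nbhd_seq:
  assumes "nbhd_seq u"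
  obtains s where "lower_limit (\<lambda>n. h -` u n) s"
proof -
  have "h -` u n \<noteq> {}" for n
    using assms y_closure unfolding nbhd_seq_def in_closure_iff by blast
  then have "\<exists>s. lower_limit (\<lambda>n. h -` u n) s"
    using lower_limit_exists[OF semilattice chain_inf, of "\<lambda>n. h -` u n"] chain_sup
      vimage_nbhd_seq_mult[OF assms] by blast
  then show ?thesis using that by blast
qed

section \<open>From single neighborhood sequences to a common upper bound\<close>

text \<open>Otherwise disjoint open sets separate the two sides. Approximate
  \<open>e = e * s\<close> by \<open>e * z\<close> with \<open>z\<close> below some
  \<open>w n\<close>; then \<open>z\<close> is below a point \<open>a\<close> whose image is near
  \<open>y\<close>, so \<open>h (e * z)\<close> equals \<open>h (e * z) * h a\<close> and is near
  both \<open>h e\<close> and \<open>h e * y\<close>.\<close>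

lemma below_lower_limits:
  assumes "\<And>V. open V \<Longrightarrow> y \<in> V \<Longrightarrow>
    \<exists>u s. nbhd_seq u \<and> u 0 \<subseteq> V \<and> lower_limit (\<lambda>n. h -` u n) s \<and> e \<preceq> s"
  shows "h e * y = h e"
proof (rule ccontr)
  assume "h e * y \<noteq> h e"
  then obtain P Q where PQ: "open P" "open Q" "h e * y \<in> P" "h e \<in> Q" "P \<inter> Q = {}"
    using hausdorff[of "h e * y" "h e"] by blast
  obtain W V where WV: "open W" "h e \<in> W" "open V" "y \<in> V"
      "\<And>a b. a \<in> W \<Longrightarrow> b \<in> V \<Longrightarrow> a * b \<in> P"
    using open_mult_nhds[OF PQ(1,3)] by metis
  obtain u s where us: "nbhd_seq u" "u 0 \<subseteq> V" "lower_limit (\<lambda>n. h -` u n) s" "e \<preceq> s"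
    using assms WV(3,4) by blast
  obtain w where w: "\<And>m n. m \<le> n \<Longrightarrow> w m \<preceq> w n" "is_sup natural_order (range w) s"
      "\<And>n. \<exists>D\<in>Chains natural_order. D \<noteq> {} \<and> D \<subseteq> h -` u n \<and> is_inf natural_order D (w n)"
    using us(3) unfolding lower_limit_def by blast
  have "range w \<in> Chains natural_order"
    unfolding Chains_def using w(1) by (auto, metis nat_le_linear)
  then have "s \<in> closure (down natural_order (range w))"
    using chain_sup[of "range w"] w(2) is_sup_unique[OF semilattice] by blast
  then have "e * s \<in> closure ((*) e ` down natural_order (range w))"
    using closure_mult[of "{e}" "down natural_order (range w)" "(*) e ` down natural_order (range w)" e s]
      closure_subset[of "{e}"] by blast
  then have "e \<in> closure ((*) e ` down natural_order (range w))"
    using us(4) by (simp add: natural_le_iff)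
  moreover have "open (h -` (W \<inter> Q))" "e \<in> h -` (W \<inter> Q)"
    using cont WV(1,2) PQ(2,4) by (auto simp: open_vimage)
  ultimately obtain z n where z: "h (e * z) \<in> W \<inter> Q" "z \<preceq> w n"
    unfolding in_closure_iff down_def by blast
  obtain a where a: "h a \<in> u n" "w n \<preceq> a"
    using w(3)[of n] unfolding is_inf_def by blast
  have "h a \<in> V"
    using vimage_nbhd_seq_antimono[OF us(1), of 0 n] a(1) us(2) by blast
  then have "h (e * z) * h a \<in> P" using WV(5) z(1) by blast
  moreover have "e * z * a = e * z"
    using le_trans[OF z(2) a(2)] unfolding natural_le_iff by (simp add: mult.assoc)
  ultimately show False using z(1) PQ(5) by (metis Int_iff disjoint_iff hom)
qed

text \<open>The equation \<open>h s * y = h s\<close> expresses that \<open>h s\<close> is below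
  \<open>y\<close>. The set \<open>T\<close> of points satisfying it is a closed lower set, hence
  contains suprema of its chains, and the compactness lemma applies in \<open>T\<close> to the
  principal filters above the \<open>e u\<close>.\<close>

lemma directed_limit:
  fixes S :: "(nat \<Rightarrow> 'b set) \<Rightarrow> 'a set" and e :: "(nat \<Rightarrow> 'b set) \<Rightarrow> 'a"
  assumes mono: "\<And>u v. nbhd_seq u \<Longrightarrow> nbhd_seq v \<Longrightarrow> (\<And>n. u n \<subseteq> v n) \<Longrightarrow> S u \<subseteq> S v"
    and e: "\<And>u. nbhd_seq u \<Longrightarrow> is_inf natural_order (S u) (e u)"
    and lim: "\<And>u s. nbhd_seq u \<Longrightarrow> lower_limit (\<lambda>n. h -` u n) s \<Longrightarrow> s \<in> S u"
  shows "\<exists>s. h s * y = h s \<and> (\<forall>u. nbhd_seq u \<longrightarrow> e u \<preceq> s)"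
proof -
  define T where "T = {x. h x * y = h x}"
  have e_mono: "e v \<preceq> e u" if "nbhd_seq u" "nbhd_seq v" "\<And>n. u n \<subseteq> v n" for u v
    using e[OF that(1)] e[OF that(2)] mono[OF that] unfolding is_inf_def by blast
  have e_T: "e u \<in> T" if u: "nbhd_seq u" for u
    unfolding T_def mem_Collect_eq
  proof (rule below_lower_limits)
    fix V assume "open V" "y \<in> V"
    then obtain v where v: "nbhd_seq v" "v 0 \<subseteq> V" by (rule nbhd_seq_exists)
    \<comment> \<open>Refining \<open>u\<close> by \<open>v\<close> places \<open>e u\<close> below
      \<open>e ?v\<close>, hence below a lower limit for a sequence that starts inside
      \<open>V\<close>.\<close>
    let ?v = "\<lambda>n. u n \<inter> v n"
    have nv: "nbhd_seq ?v" using u v(1) by (rule nbhd_seq_Int)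
    then obtain s where s: "lower_limit (\<lambda>n. h -` ?v n) s" by (rule lower_limit_nbhd_seq)
    have "e ?v \<preceq> s" using e[OF nv] lim[OF nv s] unfolding is_inf_def by blast
    moreover have "e u \<preceq> e ?v" by (rule e_mono[OF nv u]) simp
    ultimately have "e u \<preceq> s" using le_trans by blast
    then show "\<exists>v s. nbhd_seq v \<and> v 0 \<subseteq> V \<and> lower_limit (\<lambda>n. h -` v n) s \<and> e u \<preceq> s"
      using nv s v(2) by (intro exI[of _ ?v] exI[of _ s]) auto
  qed
  have T_down: "x \<in> T" if "x \<preceq> z" "z \<in> T" for x z
  proof -
    have "h x = h x * h z" using that(1) by (simp add: natural_le_iff flip: hom)
    then have "h x * y = h x * (h z * y)" by (simp flip: mult.assoc)
    then show ?thesis using that(2) \<open>h x = h x * h z\<close> unfolding T_def by simp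
  qed
  have T_closed: "closed T"
    unfolding T_def by (intro closed_Collect_eq continuous_on_mult' cont continuous_on_const)
  have "T \<inter> (\<Inter>u\<in>Collect nbhd_seq. {x. e u \<preceq> x}) \<noteq> {}"
  proof (rule finite_intersection_property_least)
    show "antisym (natural_order :: 'a rel)"
      using le_antisym by (auto intro: antisymI)
  next
    \<comment> \<open>The intersection contains its own infimum: \<open>T\<close> is a lower set,
      and each \<open>e u\<close> with \<open>u\<close> in \<open>J\<close> is a lower bound of the
      intersection.\<close>
    fix J assume ne: "T \<inter> (\<Inter>u\<in>J. {x. e u \<preceq> x}) \<noteq> {}" (is "?Z \<noteq> {}")
    then obtain i where i: "is_inf natural_order ?Z i"
      using inf_exists[OF semilattice chain_inf] by blast
    have "i \<in> T" using i ne T_down unfolding is_inf_def by blast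
    moreover have "e u \<preceq> i" if "u \<in> J" for u
      using i that unfolding is_inf_def by blast
    ultimately show "\<exists>m\<in>?Z. \<forall>x\<in>?Z. m \<preceq> x"
      using i unfolding is_inf_def by blast
  next
    fix C assume C: "C \<in> Chains (natural_order :: 'a rel)" "C \<noteq> {}" "C \<subseteq> T"
    then obtain s where s: "is_sup natural_order C s" "s \<in> closure (down natural_order C)"
      using chain_sup by blast
    have "down natural_order C \<subseteq> T" using C(3) T_down unfolding down_def by blast
    then have "s \<in> T" using s(2) T_closed closure_minimal by blast
    moreover have "s \<in> {x. e u \<preceq> x}"
      if c: "c \<in> C" "\<forall>d\<in>C. c \<preceq> d \<longrightarrow> d \<in> {x. e u \<preceq> x}" for u c
    proof -
      have "e u \<preceq> c" using c le_refl[of c] by simp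
      moreover have "c \<preceq> s" using c(1) s(1) unfolding is_sup_def by blast
      ultimately show ?thesis using le_trans by blast
    qed
    ultimately show "\<exists>s\<in>T. \<forall>u\<in>Collect nbhd_seq. \<forall>c\<in>C.
        (\<forall>d\<in>C. c \<preceq> d \<longrightarrow> d \<in> {x. e u \<preceq> x}) \<longrightarrow> s \<in> {x. e u \<preceq> x}"
      by blast
  next
    fix J :: "(nat \<Rightarrow> 'b set) set" assume J: "J \<subseteq> Collect nbhd_seq" "finite J"
    then obtain v where v: "nbhd_seq v" "\<forall>u\<in>J. \<forall>n. v n \<subseteq> u n" using nbhd_seq_finite by blast
    have "e u \<preceq> e v" if "u \<in> J" for u
      using e_mono[of v u] v J(1) that by blast
    then have "e v \<in> T \<inter> (\<Inter>u\<in>J. {x. e u \<preceq> x})" using e_T[OF v(1)] by blast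
    then show "T \<inter> (\<Inter>u\<in>J. {x. e u \<preceq> x}) \<noteq> {}" by blast
  qed
  then show ?thesis unfolding T_def by blast
qed

section \<open>The k-complete case\<close>

text \<open>Each \<open>F u\<close> is a closed subsemilattice and contains a lower limit. A point
  \<open>x\<close> common to all of them has \<open>h x\<close> in the closure of every
  \<open>u 0\<close>, which forces \<open>h x = y\<close> in a Hausdorff space.\<close>

lemma chain_limit_in_range:
  assumes inf: "\<And>C :: 'a set. C \<in> Chains natural_order \<Longrightarrow> C \<noteq> {} \<Longrightarrow>
      \<exists>i. is_inf natural_order C i \<and> i \<in> closure C"
    and sup: "\<And>C :: 'a set. C \<in> Chains natural_order \<Longrightarrow> C \<noteq> {} \<Longrightarrow>
      \<exists>s. is_sup natural_order C s \<and> s \<in> closure C"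
  shows "y \<in> range h"
proof -
  define F where "F u = (\<Inter>n. closure (h -` u n))" for u :: "nat \<Rightarrow> 'b set"
  have F_closed: "closed (F u)" for u
    unfolding F_def by blast
  have F_mult: "a * b \<in> F u" if "nbhd_seq u" "a \<in> F u" "b \<in> F u" for u a b
    using closure_mult[OF vimage_nbhd_seq_mult[OF that(1)]] that(2,3) unfolding F_def by blast
  \<comment> \<open>A tail of a chain is cofinal and so has the same supremum, which by completeness
    lies in the closure of the tail.\<close>
  have sup_tail: "s \<in> closure A"
    if C: "C \<in> Chains natural_order" "c \<in> C" "is_sup natural_order C s"
      and A: "{d \<in> C. c \<preceq> d} \<subseteq> A" for C :: "'a set" and c s A
  proof -
    let ?D = "{d \<in> C. c \<preceq> d}"
    have c: "c \<in> ?D" using C(2) le_refl by blast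
    have "?D \<in> Chains natural_order" using C(1) unfolding Chains_def by blast
    then obtain t where t: "is_sup natural_order ?D t" "t \<in> closure ?D"
      using sup[of ?D] c by blast
    have "d \<preceq> t" if "d \<in> C" for d
    proof (cases "c \<preceq> d")
      case True
      then show ?thesis using t(1) that unfolding is_sup_def by blast
    next
      case False
      then have "d \<preceq> c" using C(1,2) that unfolding Chains_def by blast
      moreover have "c \<preceq> t" using t(1) c unfolding is_sup_def by blast
      ultimately show ?thesis using le_trans by blast
    qed
    then have "is_sup natural_order C t"
      using t(1) unfolding is_sup_def by blast
    then have "s = t" using C(3) is_sup_unique[OF semilattice] by blast
    then show ?thesis using t(2) closure_mono[OF A] by blast
  qed
  have lim: "F u \<noteq> {}" if u: "nbhd_seq u" for u
  proof -
    obtain s where "lower_limit (\<lambda>n. h -` u n) s" using u by (rule lower_limit_nbhd_seq)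
    then obtain w where w: "\<And>m n. m \<le> n \<Longrightarrow> w m \<preceq> w n" "is_sup natural_order (range w) s"
        "\<And>n. \<exists>D\<in>Chains natural_order. D \<noteq> {} \<and> D \<subseteq> h -` u n \<and> is_inf natural_order D (w n)"
      unfolding lower_limit_def by blast
    have chain: "range w \<in> Chains natural_order"
      unfolding Chains_def using w(1) by (auto, metis nat_le_linear)
    have wA: "w n \<in> closure (h -` u n)" for n
    proof -
      obtain D where D: "D \<in> Chains natural_order" "D \<noteq> {}" "D \<subseteq> h -` u n"
          "is_inf natural_order D (w n)"
        using w(3) by blast
      then obtain i where "is_inf natural_order D i" "i \<in> closure D" using inf by blast
      then show ?thesis
        using D(4) is_inf_unique[OF semilattice] closure_mono[OF D(3)] by blast
    qed
    have "s \<in> closure (closure (h -` u n))" for n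
    proof (rule sup_tail[OF chain _ w(2), of "w n"])
      \<comment> \<open>The tail above \<open>w n\<close> is taken by order, not by index: an
        earlier \<open>w m\<close> can occur in it only if it equals \<open>w n\<close>.\<close>
      have "w m \<in> closure (h -` u n)" if "w n \<preceq> w m" for m
      proof (cases "n \<le> m")
        case True
        then show ?thesis using wA closure_mono[OF vimage_nbhd_seq_antimono[OF u True]] by blast
      next
        case False
        then have "w m = w n" using that w(1)[of m n] le_antisym by simp
        then show ?thesis using wA by simp
      qed
      then show "{d \<in> range w. w n \<preceq> d} \<subseteq> closure (h -` u n)" by blast
    qed simp
    then show ?thesis unfolding F_def by auto
  qed
  have "UNIV \<inter> (\<Inter>u\<in>Collect nbhd_seq. F u) \<noteq> {}"
  proof (rule finite_intersection_property_least)
    show "antisym (natural_order :: 'a rel)"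
      using le_antisym by (auto intro: antisymI)
  next
    fix J assume J: "J \<subseteq> Collect nbhd_seq" and ne: "UNIV \<inter> (\<Inter>u\<in>J. F u) \<noteq> {}" (is "?Z \<noteq> {}")
    obtain m where "m \<in> ?Z" "\<And>x. x \<in> ?Z \<Longrightarrow> m \<preceq> x"
    proof (rule subsemilattice_has_least[OF semilattice ne])
      show "a * b \<in> ?Z" if "a \<in> ?Z" "b \<in> ?Z" for a b
      proof -
        have "a * b \<in> F u" if "u \<in> J" for u
          using F_mult[of u a b] J \<open>a \<in> ?Z\<close> \<open>b \<in> ?Z\<close> that by blast
        then show ?thesis by blast
      qed
      fix C assume C: "C \<in> Chains natural_order" "C \<noteq> {}" "C \<subseteq> ?Z"
      then obtain i where i: "is_inf natural_order C i" "i \<in> closure C" using inf by blast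
      have "closed ?Z" using F_closed by auto
      then have "i \<in> ?Z" using i(2) C(3) closure_minimal by blast
      then show "\<exists>i\<in>?Z. \<forall>c\<in>C. i \<preceq> c" using i(1) unfolding is_inf_def by blast
    qed blast
    then show "\<exists>m\<in>?Z. \<forall>x\<in>?Z. m \<preceq> x" by blast
  next
    fix C assume C: "C \<in> Chains (natural_order :: 'a rel)" "C \<noteq> {}"
    then obtain s where s: "is_sup natural_order C s" using sup by blast
    have "s \<in> F u" if c: "c \<in> C" "\<forall>d\<in>C. c \<preceq> d \<longrightarrow> d \<in> F u" for u c
      using sup_tail[OF C(1) c(1) s, of "F u"] c(2) F_closed[of u] by auto
    then show "\<exists>s\<in>UNIV. \<forall>u\<in>Collect nbhd_seq. \<forall>c\<in>C. (\<forall>d\<in>C. c \<preceq> d \<longrightarrow> d \<in> F u) \<longrightarrow> s \<in> F u"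
      by blast
  next
    fix J :: "(nat \<Rightarrow> 'b set) set" assume "J \<subseteq> Collect nbhd_seq" "finite J"
    then obtain v where v: "nbhd_seq v" "\<forall>u\<in>J. \<forall>n. v n \<subseteq> u n" using nbhd_seq_finite by blast
    have "closure (h -` v n) \<subseteq> closure (h -` u n)" if "u \<in> J" for u n
      using v(2) that by (intro closure_mono vimage_mono) blast
    then have "F v \<subseteq> (\<Inter>u\<in>J. F u)" unfolding F_def by blast
    then show "UNIV \<inter> (\<Inter>u\<in>J. F u) \<noteq> {}" using lim[OF v(1)] by blast
  qed
  then obtain x where x: "\<And>u. nbhd_seq u \<Longrightarrow> x \<in> F u" by blast
  have "h x = y"
  proof (rule ccontr)
    assume "h x \<noteq> y"
    then obtain P Q where PQ: "open P" "open Q" "h x \<in> P" "y \<in> Q" "P \<inter> Q = {}"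
      using hausdorff[of "h x" y] by blast
    obtain u where u: "nbhd_seq u" "u 0 \<subseteq> Q" using PQ(2,4) by (rule nbhd_seq_exists)
    have "x \<in> closure (h -` u 0)" using x[OF u(1)] unfolding F_def by blast
    then have "h x \<in> closure (u 0)" by (rule image_in_closure[OF cont]) auto
    then show False using PQ u(2) unfolding in_closure_iff by blast
  qed
  then show ?thesis by blast
qed

section \<open>The s-complete case with a well-separated codomain\<close>

lemma image_up: "h ` up natural_order A \<subseteq> up natural_order (h ` A)"
proof -
  have "h a \<preceq> h x" if "a \<preceq> x" for a x
    using that by (simp add: natural_le_iff flip: hom)
  then show ?thesis unfolding up_def by blast
qed

text \<open>Two infima are taken, first of the chains \<open>D\<close> and then of
  \<open>S u\<close>, and each costs one closure of an upper set. As \<open>h s\<close> is above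
  \<open>h (e u)\<close>, it falls into exactly the iterated set that well-separation forbids for a
  point strictly below \<open>y\<close>.\<close>

lemma well_separated_limit_in_range:
  assumes inf: "\<And>S :: 'a set. S \<noteq> {} \<Longrightarrow> (\<And>a b. a \<in> S \<Longrightarrow> b \<in> S \<Longrightarrow> a * b \<in> S) \<Longrightarrow>
      \<exists>i. is_inf natural_order S i \<and> i \<in> closure (up natural_order S)"
    and sep: "well_separated (natural_order :: 'b rel)"
  shows "y \<in> range h"
proof -
  \<comment> \<open>The closure accounts for the infimum \<open>w n\<close> of a chain, and the
    outer \<open>up\<close> for the passage from \<open>w n\<close> to the larger point
    \<open>s\<close>.\<close>
  define B where "B U = up natural_order (closure (up natural_order (h -` U)))" for U
  define S where "S u = (\<Inter>n. B (u n))" for u :: "nat \<Rightarrow> 'b set"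
  have B_up: "up natural_order (B U) \<subseteq> B U" for U
    unfolding B_def up_idem[OF semilattice] ..
  have B_mult: "a * b \<in> B V"
    if mult: "\<And>x z. x \<in> h -` U \<Longrightarrow> z \<in> h -` U \<Longrightarrow> x * z \<in> h -` V" and that: "a \<in> B U" "b \<in> B U"
    for U V a b
  proof -
    have up: "x * z \<in> up natural_order (h -` V)"
      if "x \<in> up natural_order (h -` U)" "z \<in> up natural_order (h -` U)" for x z
      using up_mult[OF semilattice] mult that by meson
    have "x * z \<in> closure (up natural_order (h -` V))"
      if "x \<in> closure (up natural_order (h -` U))" "z \<in> closure (up natural_order (h -` U))" for x z
      using closure_mult up that by meson
    then show ?thesis
      using up_mult[OF semilattice] that unfolding B_def by meson
  qed
  have lim: "s \<in> S u" if u: "nbhd_seq u" "lower_limit (\<lambda>n. h -` u n) s" for u s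
  proof -
    obtain w where w: "is_sup natural_order (range w) s"
        "\<And>n. \<exists>D\<in>Chains natural_order. D \<noteq> {} \<and> D \<subseteq> h -` u n \<and> is_inf natural_order D (w n)"
      using u(2) unfolding lower_limit_def by blast
    have "s \<in> B (u n)" for n
    proof -
      obtain D where D: "D \<in> Chains natural_order" "D \<noteq> {}" "D \<subseteq> h -` u n"
          "is_inf natural_order D (w n)"
        using w(2) by blast
      then obtain i where "is_inf natural_order D i" "i \<in> closure (up natural_order D)"
        using inf[of D] chain_mult_closed[OF semilattice] by blast
      then have "w n \<in> closure (up natural_order (h -` u n))"
        using D(4) is_inf_unique[OF semilattice] closure_mono[OF up_mono[OF D(3)]] by blast
      moreover have "w n \<preceq> s" using w(1) unfolding is_sup_def by blast
      ultimately show ?thesis unfolding B_def up_def[of _ "closure _"] by blast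
    qed
    then show ?thesis unfolding S_def by blast
  qed
  have "\<exists>i. is_inf natural_order (S u) i \<and> i \<in> closure (up natural_order (S u))" if u: "nbhd_seq u" for u
  proof (rule inf)
    show "S u \<noteq> {}" using lim[OF u] lower_limit_nbhd_seq[OF u] by blast
    show "a * b \<in> S u" if "a \<in> S u" "b \<in> S u" for a b
    proof -
      have "a * b \<in> B (u n)" for n
      proof (rule B_mult)
        show "x * z \<in> h -` u n" if "x \<in> h -` u (Suc n)" "z \<in> h -` u (Suc n)" for x z
          using u that by (rule vimage_nbhd_seq_mult)
      qed (use that S_def in auto)
      then show ?thesis unfolding S_def by blast
    qed
  qed
  then obtain e where e: "\<And>u. nbhd_seq u \<Longrightarrow> is_inf natural_order (S u) (e u)"
      "\<And>u. nbhd_seq u \<Longrightarrow> e u \<in> closure (up natural_order (S u))"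
    by metis
  have S_mono: "S u \<subseteq> S v" if "nbhd_seq u" "nbhd_seq v" and that: "\<And>n. u n \<subseteq> v n" for u v
  proof -
    have "B (u n) \<subseteq> B (v n)" for n
      unfolding B_def by (intro up_mono closure_mono vimage_mono that)
    then show ?thesis unfolding S_def by blast
  qed
  have "\<exists>s. h s * y = h s \<and> (\<forall>u. nbhd_seq u \<longrightarrow> e u \<preceq> s)"
    by (rule directed_limit[of S e]) (fact S_mono e(1) lim)+
  then obtain s where s: "h s * y = h s" "\<And>u. nbhd_seq u \<Longrightarrow> e u \<preceq> s"
    by blast
  have "h s = y"
  proof (rule ccontr)
    assume "h s \<noteq> y"
    moreover have "h s \<preceq> y" using s(1) by (simp add: natural_le_iff)
    ultimately obtain V where V: "y \<in> interior V"
        "h s \<notin> up natural_order (closure (up natural_order (closure (up natural_order V))))"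
      using sep unfolding well_separated_def by blast
    obtain u where u: "nbhd_seq u" "u 0 \<subseteq> interior V"
      using open_interior V(1) by (rule nbhd_seq_exists)
    have "up natural_order (S u) \<subseteq> B (u 0)"
      using up_mono[of "S u" "B (u 0)"] B_up unfolding S_def by blast
    then have "e u \<in> closure (B (u 0))" using e(2)[OF u(1)] closure_mono by blast
    moreover have "h ` B (u 0) \<subseteq> up natural_order (closure (up natural_order V))"
    proof -
      have "h ` (h -` u 0) \<subseteq> V" using u(2) interior_subset[of V] by blast
      then have "h ` up natural_order (h -` u 0) \<subseteq> up natural_order V"
        using image_up[of "h -` u 0"] up_mono by blast
      then have "h ` closure (up natural_order (h -` u 0)) \<subseteq> closure (up natural_order V)"
        using image_in_closure[OF cont] by blast
      then show ?thesis
        using image_up[of "closure (up natural_order (h -` u 0))"] up_mono unfolding B_def by blast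
    qed
    ultimately have "h (e u) \<in> closure (up natural_order (closure (up natural_order V)))"
      by (rule image_in_closure[OF cont])
    moreover have "h (e u) \<preceq> h s"
      using s(2)[OF u(1)] by (simp add: natural_le_iff flip: hom)
    ultimately show False using V(2) unfolding up_def by blast
  qed
  then show ?thesis by blast
qed

section \<open>The c-complete case\<close>

text \<open>The operator \<open>B\<close> is kept abstract so as to cover a down-open domain and a
  down-open codomain at once. Since \<open>S u\<close> is a closed upper subsemilattice, it contains
  its infimum \<open>e u\<close> and then also \<open>s\<close>, so closures do not
  accumulate.\<close>

lemma closed_upper_limit_in_range:
  fixes B :: "'b set \<Rightarrow> 'a set"
  assumes inf: "\<And>F C :: 'a set. closed F \<Longrightarrow> up natural_order F \<subseteq> F \<Longrightarrow> C \<in> Chains natural_order \<Longrightarrow>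
      C \<noteq> {} \<Longrightarrow> C \<subseteq> F \<Longrightarrow> \<exists>i. is_inf natural_order C i \<and> i \<in> F"
    and B_closed: "\<And>U. closed (B U)"
    and B_up: "\<And>U. up natural_order (B U) \<subseteq> B U"
    and B_vimage: "\<And>U. h -` U \<subseteq> B U"
    and B_mono: "\<And>U V. U \<subseteq> V \<Longrightarrow> B U \<subseteq> B V"
    and B_mult: "\<And>U V a b. (\<And>x z. x \<in> U \<Longrightarrow> z \<in> U \<Longrightarrow> x * z \<in> V) \<Longrightarrow> a \<in> B U \<Longrightarrow> b \<in> B U \<Longrightarrow> a * b \<in> B V"
    and B_image: "\<And>U. h ` B U \<subseteq> closure (up natural_order U)"
  shows "y \<in> range h"
proof -
  define S where "S u = (\<Inter>n. B (u n))" for u :: "nat \<Rightarrow> 'b set"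
  have S_closed: "closed (S u)" for u
    unfolding S_def using B_closed by blast
  have S_up: "up natural_order (S u) \<subseteq> S u" for u
    using B_up unfolding S_def up_def by blast
  have lim: "s \<in> S u" if u: "nbhd_seq u" "lower_limit (\<lambda>n. h -` u n) s" for u s
  proof -
    obtain w where w: "is_sup natural_order (range w) s"
        "\<And>n. \<exists>D\<in>Chains natural_order. D \<noteq> {} \<and> D \<subseteq> h -` u n \<and> is_inf natural_order D (w n)"
      using u(2) unfolding lower_limit_def by blast
    have "s \<in> B (u n)" for n
    proof -
      obtain D where D: "D \<in> Chains natural_order" "D \<noteq> {}" "D \<subseteq> h -` u n"
          "is_inf natural_order D (w n)"
        using w(2) by blast
      then obtain i where "is_inf natural_order D i" "i \<in> B (u n)"
        using inf[OF B_closed B_up D(1,2)] B_vimage by blast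
      then have "w n \<in> B (u n)"
        using D(4) is_inf_unique[OF semilattice] by blast
      moreover have "w n \<preceq> s" using w(1) unfolding is_sup_def by blast
      ultimately show ?thesis using B_up unfolding up_def by blast
    qed
    then show ?thesis unfolding S_def by blast
  qed
  have "\<exists>i. is_inf natural_order (S u) i \<and> i \<in> S u" if u: "nbhd_seq u" for u
  proof -
    obtain m where "m \<in> S u" "\<And>x. x \<in> S u \<Longrightarrow> m \<preceq> x"
    proof (rule subsemilattice_has_least[OF semilattice])
      show "S u \<noteq> {}" using lim[OF u] lower_limit_nbhd_seq[OF u] by blast
      show "a * b \<in> S u" if "a \<in> S u" "b \<in> S u" for a b
      proof -
        have "a * b \<in> B (u n)" for n
        proof (rule B_mult)
          show "x * z \<in> u n" if "x \<in> u (Suc n)" "z \<in> u (Suc n)" for x z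
            using u that unfolding nbhd_seq_def by blast
        qed (use that S_def in auto)
        then show ?thesis unfolding S_def by blast
      qed
      fix C assume "C \<in> Chains natural_order" "C \<noteq> {}" "C \<subseteq> S u"
      then show "\<exists>i\<in>S u. \<forall>c\<in>C. i \<preceq> c"
        using inf[OF S_closed S_up] unfolding is_inf_def by meson
    qed blast
    then show ?thesis unfolding is_inf_def by blast
  qed
  then obtain e where e: "\<And>u. nbhd_seq u \<Longrightarrow> is_inf natural_order (S u) (e u)"
      "\<And>u. nbhd_seq u \<Longrightarrow> e u \<in> S u"
    by metis
  have S_mono: "S u \<subseteq> S v" if "nbhd_seq u" "nbhd_seq v" and that: "\<And>n. u n \<subseteq> v n" for u v
    using B_mono[OF that] unfolding S_def by blast
  have "\<exists>s. h s * y = h s \<and> (\<forall>u. nbhd_seq u \<longrightarrow> e u \<preceq> s)"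
    by (rule directed_limit[of S e]) (fact S_mono e(1) lim)+
  then obtain s where s: "h s * y = h s" "\<And>u. nbhd_seq u \<Longrightarrow> e u \<preceq> s"
    by blast
  have "h s = y"
  proof (rule ccontr)
    assume "h s \<noteq> y"
    \<comment> \<open>The product \<open>y * h s\<close> equals \<open>h s\<close> and thus differs
      from \<open>y\<close>. A point \<open>a\<close> of \<open>u 0\<close> below some
      \<open>z\<close> near \<open>h s\<close> satisfies \<open>a = a * z\<close>, so it would be
      near both \<open>y\<close> and \<open>y * h s\<close>.\<close>
    then obtain P Q where PQ: "open P" "open Q" "y * h s \<in> P" "y \<in> Q" "P \<inter> Q = {}"
      using hausdorff[of "y * h s" y] s(1) y_commute[of s] by auto
    obtain V W where VW: "open V" "y \<in> V" "open W" "h s \<in> W"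
        "\<And>a b. a \<in> V \<Longrightarrow> b \<in> W \<Longrightarrow> a * b \<in> P"
      using open_mult_nhds[OF PQ(1,3)] by metis
    obtain u where u: "nbhd_seq u" "u 0 \<subseteq> V \<inter> Q"
      using nbhd_seq_exists[of "V \<inter> Q"] VW(1,2) PQ(2,4) by blast
    have "s \<in> B (u 0)"
      using B_up[of "u 0"] e(2)[OF u(1)] s(2)[OF u(1)] unfolding S_def up_def by blast
    then have "h s \<in> closure (up natural_order (u 0))" using B_image by blast
    then obtain a z where "z \<in> W" "a \<in> u 0" "a * z = a"
      using VW(3,4) unfolding in_closure_iff up_def natural_order_def by blast
    then have "a \<in> P \<inter> Q" using VW(5)[of a z] u(2) by auto
    then show False using PQ(5) by blast
  qed
  then show ?thesis by blast
qed

end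

section \<open>Down-open orders, and the three cases of the theorem\<close>

text \<open>If \<open>W\<close> is a neighborhood of a point above \<open>a\<close>, then
  \<open>down r W\<close> is an open set around \<open>a\<close>. It meets \<open>A\<close> in a
  point below some point of \<open>W\<close>, and the latter is again in \<open>A\<close>.\<close>

lemma down_open_up_closure:
  assumes "down_open r" "up r A \<subseteq> A"
  shows "up r (closure A) \<subseteq> closure A"
proof
  fix z assume "z \<in> up r (closure A)"
  then obtain a where a: "a \<in> closure A" "(a, z) \<in> r" unfolding up_def by blast
  show "z \<in> closure A"
    unfolding in_closure_iff
  proof (intro allI impI)
    fix W assume "open W \<and> z \<in> W"
    then have "open (down r W)" "a \<in> down r W"
      using assms(1) a(2) unfolding down_open_def down_def by blast+
    then obtain b w where "b \<in> A" "w \<in> W" "(b, w) \<in> r"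
      using a(1) unfolding in_closure_iff down_def by blast
    then show "W \<inter> A \<noteq> {}" using assms(2) unfolding up_def by blast
  qed
qed

theorem theorem1p6:
  fixes h :: "'a::topological_semigroup_mult \<Rightarrow> 'b::{topological_semigroup_mult, t2_space}"
  assumes "semilattice ((*) :: 'a \<Rightarrow> 'a \<Rightarrow> 'a)"
    and "continuous_on UNIV h"
    and "\<And>x y. h (x * y) = h x * h y"
    and "k_complete TYPE('a)
      \<or> (s_complete TYPE('a) \<and>
          semilattice ((*) :: 'b \<Rightarrow> 'b \<Rightarrow> 'b) \<and> well_separated (natural_order :: 'b rel))
      \<or> (c_complete TYPE('a) \<and>
          (down_open (natural_order :: 'a rel) \<or>
           semilattice ((*) :: 'b \<Rightarrow> 'b \<Rightarrow> 'b) \<and> down_open (natural_order :: 'b rel)))"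
  shows "closed (range h)"
proof -
  note sl = assms(1) and cont = assms(2) and hom = assms(3)
  have limit: "image_limit h y"
    if "y \<in> closure (range h)"
      and "\<And>C :: 'a set. C \<in> Chains natural_order \<Longrightarrow> C \<noteq> {} \<Longrightarrow>
        (\<exists>i. is_inf natural_order C i) \<and>
        (\<exists>s. is_sup natural_order C s \<and> s \<in> closure (down natural_order C))" for y
    by (intro image_limit.intro sl cont hom that(1)) (use that(2) in blast)+
  have c_inf: "\<exists>i. is_inf natural_order C i \<and> i \<in> F"
    if "c_complete TYPE('a)" "closed F" "up natural_order F \<subseteq> F"
      "C \<in> Chains natural_order" "C \<noteq> {}" "C \<subseteq> F" for F C :: "'a set"
  proof -
    have "F = up natural_order F" using that(3) up_increasing[OF sl, of F] by blast
    then show ?thesis using that unfolding c_complete_def by blast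
  qed
  have c_chain: "(\<exists>i. is_inf natural_order C i) \<and>
      (\<exists>s. is_sup natural_order C s \<and> s \<in> closure (down natural_order C))"
    if "c_complete TYPE('a)" "C \<in> Chains natural_order" "C \<noteq> {}" for C :: "'a set"
  proof -
    have "closed (UNIV :: 'a set)" "UNIV = up natural_order (UNIV :: 'a set)"
      using up_increasing[OF sl, of UNIV] by auto
    then show ?thesis using that unfolding c_complete_def by blast
  qed
  have "y \<in> range h" if y: "y \<in> closure (range h)" for y
    using assms(4)
  proof (elim disjE conjE)
    assume k: "k_complete TYPE('a)"
    have "C \<subseteq> down natural_order C" for C :: "'a set"
      using natural_le_refl[OF sl] unfolding down_def by blast
    then have down: "closure C \<subseteq> closure (down natural_order C)" for C :: "'a set"
      by (rule closure_mono)
    have "(\<exists>i. is_inf natural_order C i) \<and>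
        (\<exists>s. is_sup natural_order C s \<and> s \<in> closure (down natural_order C))"
      if "C \<in> Chains natural_order" "C \<noteq> {}" for C :: "'a set"
      using k that down[of C] unfolding k_complete_def by blast
    with y have "image_limit h y" by (rule limit)
    then interpret image_limit h y .
    show ?thesis
      using k unfolding k_complete_def by (intro chain_limit_in_range) simp_all
  next
    assume s: "s_complete TYPE('a)" and sep: "well_separated (natural_order :: 'b rel)"
    have inf: "\<exists>i. is_inf natural_order S i \<and> i \<in> closure (up natural_order S)"
      if "S \<noteq> {}" "\<And>a b. a \<in> S \<Longrightarrow> b \<in> S \<Longrightarrow> a * b \<in> S" for S :: "'a set"
      using s that unfolding s_complete_def by simp
    \<comment> \<open>A chain is a subsemilattice, as the product of two comparable elements is the
      smaller one; so its infimum exists as well.\<close>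
    have "(\<exists>i. is_inf natural_order C i) \<and>
        (\<exists>s. is_sup natural_order C s \<and> s \<in> closure (down natural_order C))"
      if "C \<in> Chains natural_order" "C \<noteq> {}" for C :: "'a set"
      using inf[of C] s that chain_mult_closed[OF sl that(1)] unfolding s_complete_def by blast
    with y have "image_limit h y" by (rule limit)
    then interpret image_limit h y .
    show ?thesis using inf sep by (rule well_separated_limit_in_range)
  next
    assume c: "c_complete TYPE('a)" and down: "down_open (natural_order :: 'a rel)"
    note up_props = up_increasing[OF sl] up_idem[OF sl]
    note inf = c_inf[OF c]
    have "image_limit h y" using y c_chain[OF c] by (rule limit)
    then interpret image_limit h y .
    show ?thesis
    \<comment> \<open>The closure is taken in the domain, whose down-openness keeps it an upper
      set.\<close>
    proof (rule closed_upper_limit_in_range[OF inf, of "\<lambda>U. closure (up natural_order (h -` U))"])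
      fix U V :: "'b set" and a b :: 'a
      show "up natural_order (closure (up natural_order (h -` U))) \<subseteq> closure (up natural_order (h -` U))"
        by (rule down_open_up_closure[OF down]) (simp add: up_props)
      show "h -` U \<subseteq> closure (up natural_order (h -` U))"
        using up_props(1) closure_subset by blast
      show "closure (up natural_order (h -` U)) \<subseteq> closure (up natural_order (h -` V))" if "U \<subseteq> V"
        using that by (intro closure_mono up_mono vimage_mono)
      show "h ` closure (up natural_order (h -` U)) \<subseteq> closure (up natural_order U)"
        using image_in_closure[OF cont] image_up[of "h -` U"] up_mono[OF image_vimage_subset[of h U]]
        by blast
      assume mult: "\<And>x z. x \<in> U \<Longrightarrow> z \<in> U \<Longrightarrow> x * z \<in> V"
      have vimage_mult: "x * z \<in> h -` V" if "x \<in> h -` U" "z \<in> h -` U" for x z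
        using mult that by (simp add: hom)
      have "x * z \<in> up natural_order (h -` V)"
        if "x \<in> up natural_order (h -` U)" "z \<in> up natural_order (h -` U)" for x z
        using up_mult[OF sl] vimage_mult that by meson
      then show "a * b \<in> closure (up natural_order (h -` V))"
        if "a \<in> closure (up natural_order (h -` U))" "b \<in> closure (up natural_order (h -` U))"
        using closure_mult that by meson
    qed simp_all
  next
    assume c: "c_complete TYPE('a)" and slb: "semilattice ((*) :: 'b \<Rightarrow> 'b \<Rightarrow> 'b)"
      and down: "down_open (natural_order :: 'b rel)"
    note inf = c_inf[OF c]
    have "image_limit h y" using y c_chain[OF c] by (rule limit)
    then interpret image_limit h y .
    show ?thesis
    \<comment> \<open>Now the closure is taken in the codomain, where down-openness makes it an
      upper set; its preimage under the continuous, order-preserving map \<open>h\<close> is closed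
      and upper.\<close>
    proof (rule closed_upper_limit_in_range[OF inf, of "\<lambda>U. h -` closure (up natural_order U)"])
      fix U V :: "'b set" and a b :: 'a
      show "closed (h -` closure (up natural_order U))"
        using cont by (simp add: closed_vimage)
      have "up natural_order (closure (up natural_order U)) \<subseteq> closure (up natural_order U)"
        by (rule down_open_up_closure[OF down]) (simp add: up_idem[OF slb])
      then show "up natural_order (h -` closure (up natural_order U)) \<subseteq> h -` closure (up natural_order U)"
        using image_up[of "h -` closure (up natural_order U)"]
          up_mono[OF image_vimage_subset[of h "closure (up natural_order U)"]] by blast
      show "h -` U \<subseteq> h -` closure (up natural_order U)"
        using up_increasing[OF slb] closure_subset by blast
      show "h -` closure (up natural_order U) \<subseteq> h -` closure (up natural_order V)" if "U \<subseteq> V"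
        using that by (intro closure_mono up_mono vimage_mono)
      assume mult: "\<And>x z. x \<in> U \<Longrightarrow> z \<in> U \<Longrightarrow> x * z \<in> V"
      have "x * z \<in> up natural_order V"
        if "x \<in> up natural_order U" "z \<in> up natural_order U" for x z
        using up_mult[OF slb] mult that by meson
      then have "x * z \<in> closure (up natural_order V)"
        if "x \<in> closure (up natural_order U)" "z \<in> closure (up natural_order U)" for x z
        using closure_mult that by meson
      then show "a * b \<in> h -` closure (up natural_order V)"
        if "a \<in> h -` closure (up natural_order U)" "b \<in> h -` closure (up natural_order U)"
        using that by (simp add: hom)
    qed auto
  qed
  then show ?thesis
    by (metis closure_subset_eq subsetI)
qed

end
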